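(* Let $S_{\rm lcm}(n)$ denote the set of permutations $\pi$ of $[n]=\{1,\dots,n\}$ such that $\operatorname{lcm}[j,\pi(j)]\le n$ for every $j\in[n]$. For any positive integer $b$, \[ \#S_{\rm lcm}(n)\ge \exp\big((c(b)\varphi(b)/b+o(1))\,n\big)\quad\text{as } n\to\infty, \] where $\varphi$ is Euler's totient function and $c(b)$ is defined below.
   Context: For a positive integer $b$ and a divisor $a\mid b$, let $s(a,b)=\{d\mid b: d\le a\}$, and let $p(a,b)$ be the number of permutations $\sigma$ of $s(a,b)$ such that $\operatorname{lcm}[d,\sigma(d)]\le a$ for every $d\in s(a,b)$. Let $\tau(b)$ be the number of positive divisors of $b$, and write the divisors of $b$ in increasing order as $1=a_1<a_2<\dots<a_{\tau(b)}=b$. Define \[ c(b)=\frac{\log(\tau(b)!)}{b}+\sum_{i=1}^{\tau(b)-1}\Big(\frac1{a_i}-\frac1{a_{i+1}}\Big)\log p(a_i,b). \] *)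

theory Defs
  imports Complex_Main "HOL-Combinatorics.Permutations" "HOL-Number_Theory.Totient"
begin

(* Permutations of a set A are functions on the whole type that are the identity outside A
   ("permutes"), so cardinalities of such sets of functions count permutations of A. *)

definition S_lcm :: "nat \<Rightarrow> (nat \<Rightarrow> nat) set" where
  "S_lcm n = {\<pi>. \<pi> permutes {1..n} \<and> (\<forall>j\<in>{1..n}. lcm j (\<pi> j) \<le> n)}"

definition small_divisors :: "nat \<Rightarrow> nat \<Rightarrow> nat set" where
  "small_divisors a b = {d. d dvd b \<and> d \<le> a}"

definition lcm_perm_count :: "nat \<Rightarrow> nat \<Rightarrow> nat" where
  "lcm_perm_count a b =
     card {\<sigma>. \<sigma> permutes small_divisors a b \<and> (\<forall>d\<in>small_divisors a b. lcm d (\<sigma> d) \<le> a)}"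

definition tau :: "nat \<Rightarrow> nat" where
  "tau b = card {d. d dvd b}"

(* The i-th divisor of b in increasing order, with i counted from 1; meaningful for b > 0 and
   1 \<le> i \<le> tau b. *)
definition nth_divisor :: "nat \<Rightarrow> nat \<Rightarrow> nat" where
  "nth_divisor b i = sorted_list_of_set {d. d dvd b} ! (i - 1)"

definition c_lcm :: "nat \<Rightarrow> real" where
  "c_lcm b = ln (fact (tau b)) / real b +
     (\<Sum>i = 1..<tau b.
        (1 / real (nth_divisor b i) - 1 / real (nth_divisor b (i + 1))) *
        ln (real (lcm_perm_count (nth_divisor b i) b)))"

end

(* Every integer has at most one factorization m * d with m coprime to b and d dividing b, so the
   blocks {m * d <= n : d dvd b}, with m coprime to b, are disjoint.  Since
   lcm (m * d) (m * d') = m * lcm d d', the permutations in S_lcm n that act on each block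
   separately number the product of p(n div m, b) over all m <= n coprime to b.  The factor depends
   only on the consecutive divisors of b between which n / m lies, and the numbers coprime to b have
   density totient b / b with bounded error; taking logarithms gives the bound with an error term
   O(1/n) in place of o(1). *)

theory Submission
  imports Defs
begin

section \<open>Permutations of the divisors of \<open>b\<close> below a threshold\<close>

definition admissible_perms :: "nat \<Rightarrow> nat \<Rightarrow> (nat \<Rightarrow> nat) set" where
  "admissible_perms a b =
     {\<sigma>. \<sigma> permutes small_divisors a b \<and> (\<forall>d\<in>small_divisors a b. lcm d (\<sigma> d) \<le> a)}"

text \<open>Leaving out 0 makes \<open>coprime_upto b b\<close> the set of totatives of
  \<open>b\<close>, so its cardinality is \<open>totient b\<close> even for
  \<open>b = 1\<close>.\<close>

definition coprime_upto :: "nat \<Rightarrow> nat \<Rightarrow> nat set" where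
  "coprime_upto b x = {m \<in> {0<..x}. coprime m b}"

lemma lcm_perm_count_eq_card: "lcm_perm_count a b = card (admissible_perms a b)"
  by (simp add: lcm_perm_count_def admissible_perms_def)

lemma finite_small_divisors: "finite (small_divisors a b)"
  by (rule finite_subset[of _ "{..a}"]) (auto simp: small_divisors_def)

text \<open>The identity is always admissible. Positivity keeps every logarithm of a count
  nonnegative and lets \<open>exp\<close> undo \<open>ln\<close>.\<close>

lemma lcm_perm_count_pos: "lcm_perm_count a b > 0"
proof -
  have "finite (admissible_perms a b)"
    by (rule finite_subset[OF _ finite_permutations[OF finite_small_divisors[of a b]]])
       (auto simp: admissible_perms_def)
  moreover have "id \<in> admissible_perms a b"
    by (auto simp: admissible_perms_def permutes_id small_divisors_def)
  ultimately show ?thesis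
    by (auto simp: lcm_perm_count_eq_card card_gt_0_iff)
qed

text \<open>The lcm of two divisors of \<open>b\<close> again divides \<open>b\<close>, so the
  threshold is only ever compared with divisors of \<open>b\<close>, both in the domain and in the
  lcm condition.\<close>

lemma lcm_perm_count_cong:
  assumes "\<And>d. d dvd b \<Longrightarrow> d \<le> x \<longleftrightarrow> d \<le> a"
  shows "lcm_perm_count x b = lcm_perm_count a b"
proof -
  have s: "small_divisors x b = small_divisors a b"
    using assms by (auto simp: small_divisors_def)
  have "lcm d (\<sigma> d) \<le> x \<longleftrightarrow> lcm d (\<sigma> d) \<le> a"
    if "\<sigma> permutes small_divisors a b" "d \<in> small_divisors a b" for \<sigma> d
  proof (rule assms)
    have "\<sigma> d \<in> small_divisors a b" using that by (simp add: permutes_in_image)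
    then show "lcm d (\<sigma> d) dvd b" using that by (simp add: small_divisors_def)
  qed
  then show ?thesis
    unfolding lcm_perm_count_eq_card admissible_perms_def s by (intro arg_cong[of _ _ card]) auto
qed

text \<open>All divisors of \<open>b\<close> and all their lcms are at most \<open>b\<close>, so
  every permutation of the full divisor set is admissible.\<close>

lemma lcm_perm_count_top:
  assumes "b > 0" "b \<le> a"
  shows "lcm_perm_count a b = fact (tau b)"
proof -
  have s: "small_divisors a b = {d. d dvd b}"
    using assms by (auto simp: small_divisors_def intro: dvd_imp_le[THEN order_trans])
  have "lcm d (\<sigma> d) \<le> a" if "\<sigma> permutes {d. d dvd b}" "d dvd b" for \<sigma> d
  proof -
    have "\<sigma> d dvd b" using permutes_in_image[OF that(1), of d] that(2) by simp
    then have "lcm d (\<sigma> d) dvd b" using that by simp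
    then have "lcm d (\<sigma> d) \<le> b" using assms(1) by (rule dvd_imp_le)
    then show ?thesis using assms(2) by simp
  qed
  then have "admissible_perms a b = {\<sigma>. \<sigma> permutes {d. d dvd b}}"
    unfolding admissible_perms_def s by auto
  then show ?thesis
    using assms(1) by (simp add: lcm_perm_count_eq_card tau_def card_permutations)
qed

section \<open>Gluing block permutations into an element of \<open>S_lcm n\<close>\<close>

text \<open>The divisor part of a product is recovered as its gcd with \<open>b\<close>; this yields
  both the disjointness of the blocks and the decoding used in \<open>glue\<close>.\<close>

lemma gcd_coprime_mult_divisor:
  fixes m d b :: nat
  assumes "coprime m b" "d dvd b"
  shows "gcd (m * d) b = d"
proof -
  have "gcd (m * d) b = gcd d b"
    using assms(1) by (intro gcd_mult_left_left_cancel) (simp add: coprime_commute)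
  then show ?thesis using assms(2) by (simp add: gcd_nat.absorb1)
qed

lemma prod_lcm_perm_count_le_card_S_lcm:
  assumes b: "b > 0"
  shows "(\<Prod>m\<in>coprime_upto b n. lcm_perm_count (n div m) b) \<le> card (S_lcm n)"
proof -
  define M where "M = coprime_upto b n"
  define sd where "sd m = small_divisors (n div m) b" for m
  define Q where "Q m = admissible_perms (n div m) b" for m
  \<comment> \<open>\<open>B\<close> is the union of the blocks; \<open>d \<le> n div m\<close> says
    that \<open>m * d \<le> n\<close>. It can be a proper subset of \<open>{1..n}\<close>: for
    \<open>b = 2\<close> it omits 4.\<close>
  define B where "B = {m * d |m d. m \<in> M \<and> d \<in> sd m}"
  \<comment> \<open>An element of \<open>B\<close> is decoded into its block index \<open>m\<close>
    and divisor \<open>d\<close>, and \<open>F m\<close> then moves \<open>d\<close> inside that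
    block.\<close>
  define glue where "glue F j = (if j \<in> B then let d = gcd j b; m = j div d in m * F m d else j)"
    for F :: "nat \<Rightarrow> nat \<Rightarrow> nat" and j
  have finM: "finite M" by (simp add: M_def coprime_upto_def)
  have sd_dvd: "d dvd b" "0 < d" if "d \<in> sd m" for m d
    using that b by (auto simp: sd_def small_divisors_def intro: dvd_pos_nat)
  have M: "0 < m" "coprime m b" if "m \<in> M" for m
    using that by (auto simp: M_def coprime_upto_def)
  have B_sub: "B \<subseteq> {1..n}"
  proof
    fix j assume "j \<in> B"
    then obtain m d where *: "m \<in> M" "d \<in> sd m" "j = m * d" by (auto simp: B_def)
    have "m * d \<le> m * (n div m)" using * by (simp add: sd_def small_divisors_def)
    also have "\<dots> \<le> n" by simp
    finally show "j \<in> {1..n}" using M[OF *(1)] sd_dvd[OF *(2)] * by (simp add: Suc_le_eq)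
  qed
  then have finB: "finite B" using finite_subset by blast
  have uniq: "m = m' \<and> d = d'"
    if "m \<in> M" "m' \<in> M" "d \<in> sd m" "d' \<in> sd m'" "m * d = m' * d'" for m m' d d'
  proof -
    have "d = d'"
      using gcd_coprime_mult_divisor[OF M(2)[OF that(1)] sd_dvd(1)[OF that(3)]]
        gcd_coprime_mult_divisor[OF M(2)[OF that(2)] sd_dvd(1)[OF that(4)]] that(5) by simp
    then show ?thesis using that(5) sd_dvd(2)[OF that(3)] by simp
  qed
  have glue_eq: "glue F (m * d) = m * F m d" if "m \<in> M" "d \<in> sd m" for F m d
  proof -
    have "m * d \<in> B" using that by (auto simp: B_def)
    then show ?thesis
      using that gcd_coprime_mult_divisor[OF M(2)[OF that(1)] sd_dvd(1)[OF that(2)]] sd_dvd(2)[OF that(2)]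
      by (simp add: glue_def Let_def)
  qed
  have Q_perm: "F m permutes sd m" and Q_lcm: "\<And>d. d \<in> sd m \<Longrightarrow> lcm d (F m d) \<le> n div m"
    if "F \<in> PiE M Q" "m \<in> M" for F m
    using PiE_mem[OF that] by (auto simp: Q_def sd_def admissible_perms_def)
  have glue_in: "glue F \<in> S_lcm n" if F: "F \<in> PiE M Q" for F
  proof -
    have sub: "glue F ` B \<subseteq> B"
    proof
      fix y assume "y \<in> glue F ` B"
      then obtain m d where *: "m \<in> M" "d \<in> sd m" "y = glue F (m * d)" by (auto simp: B_def)
      have "F m d \<in> sd m" using permutes_in_image[OF Q_perm[OF F *(1)]] * by simp
      then show "y \<in> B" using * glue_eq by (auto simp: B_def)
    qed
    have inj: "inj_on (glue F) B"
    proof (rule inj_onI)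
      fix x y assume "x \<in> B" "y \<in> B" and eq: "glue F x = glue F y"
      then obtain m d m' d' where x: "m \<in> M" "d \<in> sd m" "x = m * d"
        and y: "m' \<in> M" "d' \<in> sd m'" "y = m' * d'" by (auto simp: B_def)
      have "F m d \<in> sd m" "F m' d' \<in> sd m'"
        using permutes_in_image[OF Q_perm[OF F]] x y by simp_all
      moreover have "m * F m d = m' * F m' d'" using eq x y glue_eq by simp
      ultimately have "m = m'" "F m d = F m' d'" using uniq[of m m'] x y by blast+
      then have "d = d'" using permutes_inj[OF Q_perm[OF F x(1)]] by (auto dest: injD)
      then show "x = y" using x y \<open>m = m'\<close> by simp
    qed
    \<comment> \<open>An injective self-map of a finite set is onto, so no inverse of
      \<open>glue F\<close> has to be constructed.\<close>
    have "glue F ` B = B" by (rule endo_inj_surj[OF finB sub inj])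
    with inj have "bij_betw (glue F) B B" by (simp add: bij_betw_def)
    then have "glue F permutes B" by (rule bij_imp_permutes) (simp add: glue_def)
    then have perm: "glue F permutes {1..n}" using B_sub by (rule permutes_subset)
    have "lcm j (glue F j) \<le> n" if "j \<in> {1..n}" for j
    proof (cases "j \<in> B")
      case True
      then obtain m d where *: "m \<in> M" "d \<in> sd m" "j = m * d" by (auto simp: B_def)
      have "lcm j (glue F j) = m * lcm d (F m d)"
        using * glue_eq by (simp add: lcm_mult_left)
      also have "\<dots> \<le> m * (n div m)" using Q_lcm[OF F *(1,2)] by simp
      also have "\<dots> \<le> n" by simp
      finally show ?thesis .
    next
      case False
      \<comment> \<open>Points outside all blocks are fixed, and
        \<open>lcm j j = j \<le> n\<close>.\<close>
      then show ?thesis using that by (simp add: glue_def)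
    qed
    then show ?thesis using perm by (simp add: S_lcm_def)
  qed
  have inj: "inj_on glue (PiE M Q)"
  proof (rule inj_onI)
    fix F G assume F: "F \<in> PiE M Q" and G: "G \<in> PiE M Q" and eq: "glue F = glue G"
    show "F = G"
    proof (rule PiE_ext[OF F G])
      fix m assume m: "m \<in> M"
      show "F m = G m"
      proof
        fix d
        show "F m d = G m d"
        proof (cases "d \<in> sd m")
          case True
          then have "m * F m d = m * G m d" using glue_eq[OF m True] eq by metis
          then show ?thesis using M(1)[OF m] by simp
        next
          case False
          \<comment> \<open>Both functions are the identity off \<open>sd m\<close>, so agreement on
            \<open>sd m\<close> extends to the whole type.\<close>
          then show ?thesis using Q_perm[OF F m] Q_perm[OF G m] by (simp add: permutes_not_in)
        qed
      qed
    qed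
  qed
  have "finite (S_lcm n)"
    by (rule finite_subset[OF _ finite_permutations[of "{1..n}"]]) (auto simp: S_lcm_def)
  then have "card (PiE M Q) \<le> card (S_lcm n)"
    using glue_in by (intro card_inj_on_le[OF inj]) auto
  then show ?thesis
    using finM by (simp add: card_PiE Q_def M_def lcm_perm_count_eq_card)
qed

section \<open>Counting integers coprime to \<open>b\<close>\<close>

lemma finite_coprime_upto [simp]: "finite (coprime_upto b x)"
  by (simp add: coprime_upto_def)

lemma card_coprime_upto_Suc:
  "card (coprime_upto b (Suc x)) = card (coprime_upto b x) + (if coprime (Suc x) b then 1 else 0)"
proof -
  have "coprime_upto b (Suc x) =
      (if coprime (Suc x) b then insert (Suc x) (coprime_upto b x) else coprime_upto b x)"
    by (auto simp: coprime_upto_def le_Suc_eq)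
  moreover have "Suc x \<notin> coprime_upto b x" by (simp add: coprime_upto_def)
  ultimately show ?thesis by simp
qed

text \<open>Coprimality to \<open>b\<close> has period \<open>b\<close>: sliding a window of length
  \<open>b\<close> by one step drops \<open>Suc x\<close> and gains \<open>Suc x + b\<close>, which
  are coprime to \<open>b\<close> simultaneously.\<close>

lemma card_coprime_upto_add:
  "card (coprime_upto b (x + b)) = card (coprime_upto b x) + totient b"
proof (induction x)
  case 0
  then show ?case by (simp add: coprime_upto_def totient_def totatives_def)
next
  case (Suc x)
  have "coprime (Suc x + b) b \<longleftrightarrow> coprime (Suc x) b"
    by (simp only: coprime_iff_gcd_eq_1 gcd_add1)
  then show ?case
    using Suc card_coprime_upto_Suc[of b "x + b"] card_coprime_upto_Suc[of b x] by simp
qed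

lemma totient_density_le_1: "real (totient b) / real b \<le> 1"
  using totient_le[of b] by (simp add: divide_le_eq)

text \<open>Removing a full period lowers both the count and its linear approximation by exactly
  \<open>totient b\<close>, so the error is unchanged. For \<open>x < b\<close> both quantities lie
  between 0 and \<open>x\<close>.\<close>

lemma card_coprime_upto_approx:
  assumes "b > 0"
  shows "\<bar>real (card (coprime_upto b x)) - real (totient b) / real b * real x\<bar> \<le> real b"
proof (induction x rule: less_induct)
  case (less x)
  show ?case
  proof (cases "x < b")
    case True
    have "card (coprime_upto b x) \<le> card {0<..x}"
      by (intro card_mono) (auto simp: coprime_upto_def)
    then have "real (card (coprime_upto b x)) \<le> real x" by simp
    moreover have "real (totient b) / real b * real x \<le> 1 * real x"
      by (intro mult_right_mono totient_density_le_1) simp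
    moreover have "real (totient b) / real b * real x \<ge> 0" by simp
    ultimately show ?thesis using True by linarith
  next
    case False
    then have x: "real x = real (x - b) + real b" by simp
    have "real (totient b) / real b * real b = real (totient b)" using assms by simp
    then have "real (totient b) / real b * real x =
        real (totient b) / real b * real (x - b) + real (totient b)"
      unfolding x distrib_left by (rule arg_cong)
    moreover have "card (coprime_upto b x) = card (coprime_upto b (x - b)) + totient b"
      using card_coprime_upto_add[of b "x - b"] False by simp
    moreover have "x - b < x" using False assms by simp
    note less[OF this]
    ultimately show ?thesis by simp
  qed
qed

text \<open>Rounding \<open>n / a\<close> down changes the main term by at most 1, since the density
  is at most 1. The factor \<open>1 / real a\<close> is kept separate to match the terms of
  \<open>c_lcm\<close>.\<close>

lemma card_coprime_upto_div_approx:
  assumes "b > 0" "a > 0"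
  shows "\<bar>real (card (coprime_upto b (n div a))) - real (totient b) / real b * real n * (1 / real a)\<bar>
         \<le> real b + 1"
proof -
  let ?\<delta> = "real (totient b) / real b"
  have "real n / real a - real (n div a) \<ge> 0" "real n / real a - real (n div a) \<le> 1"
    using floor_divide_of_nat_eq[of n a, where ?'a = real] by (simp_all add: floor_eq_iff)
  then have "0 \<le> ?\<delta> * (real n / real a - real (n div a))"
    and "?\<delta> * (real n / real a - real (n div a)) \<le> 1 * 1"
    by (simp, intro mult_mono totient_density_le_1) auto
  then have "\<bar>?\<delta> * real (n div a) - ?\<delta> * real n * (1 / real a)\<bar> \<le> 1"
    by (simp add: right_diff_distrib abs_le_iff)
  then show ?thesis using card_coprime_upto_approx[OF assms(1), of "n div a"] by linarith
qed

section \<open>The logarithmic sum, grouped by consecutive divisors of \<open>b\<close>\<close>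

context
  fixes b :: nat
  assumes b_pos: "b > 0"
begin

lemma finite_divisors: "finite {d. d dvd b}"
  using b_pos by simp

lemma nth_divisor_index:
  assumes "d dvd b"
  obtains i where "1 \<le> i" "i \<le> tau b" "nth_divisor b i = d"
proof -
  have "d \<in> set (sorted_list_of_set {d. d dvd b})" using assms finite_divisors by simp
  then obtain k where "k < tau b" "sorted_list_of_set {d. d dvd b} ! k = d"
    by (auto simp: in_set_conv_nth tau_def)
  \<comment> \<open>List positions start at 0, divisor indices at 1.\<close>
  then show ?thesis by (intro that[of "Suc k"]) (auto simp: nth_divisor_def)
qed

lemma nth_divisor_dvd: "1 \<le> i \<Longrightarrow> i \<le> tau b \<Longrightarrow> nth_divisor b i dvd b"
  using nth_mem[of "i - 1" "sorted_list_of_set {d. d dvd b}"] finite_divisors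
  by (simp add: nth_divisor_def tau_def)

lemma nth_divisor_pos: "1 \<le> i \<Longrightarrow> i \<le> tau b \<Longrightarrow> nth_divisor b i > 0"
  using nth_divisor_dvd b_pos dvd_pos_nat by blast

lemma nth_divisor_mono:
  "1 \<le> i \<Longrightarrow> i \<le> j \<Longrightarrow> j \<le> tau b \<Longrightarrow> nth_divisor b i \<le> nth_divisor b j"
  unfolding nth_divisor_def tau_def by (intro sorted_nth_mono) auto

lemma nth_divisor_strict_mono:
  assumes "1 \<le> i" "i < j" "j \<le> tau b"
  shows "nth_divisor b i < nth_divisor b j"
  using assms sorted_wrt_nth_less[OF strict_sorted_list_of_set[of "{d. d dvd b}"], of "i - 1" "j - 1"]
  by (simp add: nth_divisor_def tau_def)

text \<open>No divisor lies strictly between two consecutive ones: comparing the index of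
  \<open>d\<close> with \<open>i\<close> settles the matter by monotonicity.\<close>

lemma divisor_less_nth_divisor_Suc:
  assumes "1 \<le> i" "i < tau b" "d dvd b"
  shows "d < nth_divisor b (Suc i) \<longleftrightarrow> d \<le> nth_divisor b i"
proof -
  obtain k where k: "1 \<le> k" "k \<le> tau b" "nth_divisor b k = d"
    using nth_divisor_index[OF assms(3)] .
  show ?thesis
  proof (cases "k \<le> i")
    case True
    then show ?thesis
      using k assms nth_divisor_mono[of k i] nth_divisor_strict_mono[of i "Suc i"] by auto
  next
    case False
    then show ?thesis
      using k assms nth_divisor_mono[of "Suc i" k] nth_divisor_strict_mono[of i "Suc i"] by auto
  qed
qed

lemma tau_pos: "tau b \<ge> 1"
  using nth_divisor_index[of 1] by fastforce

lemma nth_divisor_1: "nth_divisor b 1 = 1"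
proof -
  obtain k where "1 \<le> k" "k \<le> tau b" "nth_divisor b k = 1" using nth_divisor_index[of 1] by auto
  then show ?thesis
    using nth_divisor_mono[of 1 k] nth_divisor_pos[of 1] tau_pos by simp
qed

lemma nth_divisor_tau: "nth_divisor b (tau b) = b"
proof -
  obtain k where "1 \<le> k" "k \<le> tau b" "nth_divisor b k = b" using nth_divisor_index[of b] by auto
  then show ?thesis
    using nth_divisor_mono[of k "tau b"] nth_divisor_dvd[of "tau b"] tau_pos b_pos
    by (simp add: dvd_imp_le order_antisym)
qed

text \<open>Each induction step peels off the \<open>m\<close> with
  \<open>n div nth_divisor b (Suc k) < m \<le> n div nth_divisor b k\<close>. For these,
  \<open>n div m\<close> is at least the \<open>k\<close>-th divisor and below the next one, so the
  summand is constant. At \<open>k = 1\<close> the divisor is 1 and nothing has been peeled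
  off.\<close>

lemma sum_ln_lcm_perm_count_by_divisors:
  assumes "1 \<le> k" "k \<le> tau b"
  shows "(\<Sum>m\<in>coprime_upto b n. ln (real (lcm_perm_count (n div m) b))) =
    (\<Sum>m\<in>coprime_upto b (n div nth_divisor b k). ln (real (lcm_perm_count (n div m) b))) +
    (\<Sum>i = 1..<k. (real (card (coprime_upto b (n div nth_divisor b i))) -
        real (card (coprime_upto b (n div nth_divisor b (i + 1))))) *
      ln (real (lcm_perm_count (nth_divisor b i) b)))"
  using assms
proof (induction k rule: dec_induct)
  case base
  then show ?case by (simp add: nth_divisor_1[unfolded One_nat_def])
next
  case (step k)
  let ?C = "\<lambda>i. coprime_upto b (n div nth_divisor b i)"
  let ?l = "\<lambda>m. ln (real (lcm_perm_count (n div m) b))"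
  have k: "1 \<le> k" "k < tau b" using step by auto
  have sub: "?C (Suc k) \<subseteq> ?C k"
    using div_le_mono2[OF nth_divisor_pos nth_divisor_mono[of k "Suc k"], of n] k
    by (auto simp: coprime_upto_def)
  have "?l m = ln (real (lcm_perm_count (nth_divisor b k) b))" if "m \<in> ?C k - ?C (Suc k)" for m
  proof -
    have m: "0 < m" "m \<le> n div nth_divisor b k" "\<not> m \<le> n div nth_divisor b (Suc k)"
      using that by (auto simp: coprime_upto_def)
    have le: "nth_divisor b k \<le> n div m"
      using m(1,2) nth_divisor_pos[of k] k by (simp add: less_eq_div_iff_mult_less_eq mult.commute)
    have "n < nth_divisor b (Suc k) * m"
      using m(3) nth_divisor_pos[of "Suc k"] k
      by (simp add: less_eq_div_iff_mult_less_eq mult.commute not_le)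
    then have less: "n div m < nth_divisor b (Suc k)"
      by (simp only: div_less_iff_less_mult[OF m(1)])
    have "d \<le> n div m \<longleftrightarrow> d \<le> nth_divisor b k" if "d dvd b" for d
      using le less divisor_less_nth_divisor_Suc[OF k that] by linarith
    then have "lcm_perm_count (n div m) b = lcm_perm_count (nth_divisor b k) b"
      by (rule lcm_perm_count_cong)
    then show ?thesis by simp
  qed
  then have "(\<Sum>m\<in>?C k - ?C (Suc k). ?l m) =
      real (card (?C k - ?C (Suc k))) * ln (real (lcm_perm_count (nth_divisor b k) b))"
    by simp
  also have "real (card (?C k - ?C (Suc k))) = real (card (?C k)) - real (card (?C (Suc k)))"
    using sub by (simp add: card_Diff_subset card_mono of_nat_diff)
  finally have "(\<Sum>m\<in>?C k. ?l m) = (\<Sum>m\<in>?C (Suc k). ?l m) +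
      (real (card (?C k)) - real (card (?C (Suc k)))) * ln (real (lcm_perm_count (nth_divisor b k) b))"
    using sum.subset_diff[OF sub, of ?l] by simp
  then show ?case using step.IH k by simp
qed

text \<open>After peeling up to \<open>k = tau b\<close>, the remaining
  \<open>m \<le> n div b\<close> satisfy \<open>n div m \<ge> b\<close>, so each contributes
  \<open>ln (fact (tau b))\<close>.\<close>

lemma sum_ln_lcm_perm_count:
  "(\<Sum>m\<in>coprime_upto b n. ln (real (lcm_perm_count (n div m) b))) =
    real (card (coprime_upto b (n div b))) * ln (fact (tau b)) +
    (\<Sum>i = 1..<tau b. (real (card (coprime_upto b (n div nth_divisor b i))) -
        real (card (coprime_upto b (n div nth_divisor b (i + 1))))) *
      ln (real (lcm_perm_count (nth_divisor b i) b)))"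
proof -
  have "lcm_perm_count (n div m) b = fact (tau b)" if "m \<in> coprime_upto b (n div b)" for m
    using that b_pos
    by (intro lcm_perm_count_top)
      (simp_all add: coprime_upto_def less_eq_div_iff_mult_less_eq mult.commute)
  then have "(\<Sum>m\<in>coprime_upto b (n div b). ln (real (lcm_perm_count (n div m) b))) =
      real (card (coprime_upto b (n div b))) * ln (fact (tau b))"
    by simp
  then show ?thesis
    using sum_ln_lcm_perm_count_by_divisors[of "tau b" n] tau_pos by (simp add: nth_divisor_tau)
qed

text \<open>Every count is replaced by its linear approximation. The weights are nonnegative
  logarithms depending only on \<open>b\<close>, so lower bounds survive multiplication and the
  total error is bounded uniformly in \<open>n\<close>.\<close>

lemma sum_ln_lcm_perm_count_ge:
  "\<exists>K. \<forall>n. (\<Sum>m\<in>coprime_upto b n. ln (real (lcm_perm_count (n div m) b))) \<ge>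
      c_lcm b * real (totient b) / real b * real n - K"
\<comment> \<open>The witness for \<open>K\<close> stays open until the final \<open>show\<close>;
  \<open>n\<close> is fixed after it, so \<open>K\<close> depends on \<open>b\<close> alone.\<close>
proof (intro exI allI)
  fix n
  define \<delta> where "\<delta> = real (totient b) / real b * real n"
  define C where "C a = real (card (coprime_upto b (n div a)))" for a
  define D where "D = nth_divisor b"
  define l where "l i = ln (real (lcm_perm_count (D i) b))" for i
  have C: "\<bar>C a - \<delta> * (1 / real a)\<bar> \<le> real b + 1" if "a > 0" for a
    using card_coprime_upto_div_approx[OF b_pos that] by (simp add: C_def \<delta>_def)
  have l0: "l i \<ge> 0" for i
    using lcm_perm_count_pos[of "D i" b] by (simp add: l_def Suc_le_eq)
  have "C b \<ge> \<delta> * (1 / real b) - (real b + 1)" using C[OF b_pos] by linarith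
  then have 1: "C b * ln (fact (tau b)) \<ge> (\<delta> * (1 / real b) - (real b + 1)) * ln (fact (tau b))"
    by (intro mult_right_mono) (auto simp: fact_ge_1)
  \<comment> \<open>A difference of two counts, each off by at most \<open>\<kappa>\<close>, is off
    by at most twice that; hence the factor 2 in \<open>K\<close>.\<close>
  have diff_bound: "x - y - 2 * \<kappa> \<le> p - q" if "- (p - x) \<le> \<kappa>" "q - y \<le> \<kappa>" for p q x y \<kappa> :: real
    using that by linarith
  have "(C (D i) - C (D (i + 1))) * l i \<ge>
      (\<delta> * (1 / real (D i) - 1 / real (D (i + 1))) - 2 * (real b + 1)) * l i"
    if "i \<in> {1..<tau b}" for i
  proof (intro mult_right_mono l0)
    have "D i > 0" "D (i + 1) > 0" using nth_divisor_pos that by (auto simp: D_def)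
    from abs_le_D2[OF C[OF this(1)]] abs_le_D1[OF C[OF this(2)]]
    show "\<delta> * (1 / real (D i) - 1 / real (D (i + 1))) - 2 * (real b + 1) \<le> C (D i) - C (D (i + 1))"
      unfolding right_diff_distrib by (rule diff_bound)
  qed
  then have 2: "(\<Sum>i = 1..<tau b. (C (D i) - C (D (i + 1))) * l i) \<ge>
      (\<Sum>i = 1..<tau b. (\<delta> * (1 / real (D i) - 1 / real (D (i + 1))) - 2 * (real b + 1)) * l i)"
    by (rule sum_mono)
  have "(\<Sum>i = 1..<tau b. (\<delta> * (1 / real (D i) - 1 / real (D (i + 1))) - 2 * (real b + 1)) * l i) =
      \<delta> * (\<Sum>i = 1..<tau b. (1 / real (D i) - 1 / real (D (i + 1))) * l i) -
      2 * (real b + 1) * (\<Sum>i = 1..<tau b. l i)"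
    by (simp only: left_diff_distrib right_diff_distrib sum_subtractf sum_distrib_left mult.assoc)
  moreover have "\<delta> * c_lcm b = \<delta> * (1 / real b) * ln (fact (tau b)) +
      \<delta> * (\<Sum>i = 1..<tau b. (1 / real (D i) - 1 / real (D (i + 1))) * l i)"
    by (simp add: c_lcm_def D_def l_def distrib_left)
  moreover have "c_lcm b * real (totient b) / real b * real n = \<delta> * c_lcm b" by (simp add: \<delta>_def)
  moreover have "(\<Sum>m\<in>coprime_upto b n. ln (real (lcm_perm_count (n div m) b))) =
      C b * ln (fact (tau b)) + (\<Sum>i = 1..<tau b. (C (D i) - C (D (i + 1))) * l i)"
    using sum_ln_lcm_perm_count by (simp add: C_def D_def l_def)
  ultimately show "(\<Sum>m\<in>coprime_upto b n. ln (real (lcm_perm_count (n div m) b))) \<ge>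
      c_lcm b * real (totient b) / real b * real n - ((real b + 1) * ln (fact (tau b)) +
        2 * (real b + 1) * (\<Sum>i = 1..<tau b. ln (real (lcm_perm_count (nth_divisor b i) b))))"
    using 1 2 unfolding left_diff_distrib l_def D_def by linarith
qed

end

section \<open>From the logarithmic bound to the cardinality\<close>

theorem theorem2:
  fixes b :: nat
  assumes "b > 0"
  shows "\<exists>\<epsilon> :: nat \<Rightarrow> real. \<epsilon> \<longlonglongrightarrow> 0 \<and>
           (\<forall>n\<ge>1. real (card (S_lcm n)) \<ge>
              exp ((c_lcm b * real (totient b) / real b + \<epsilon> n) * real n))"
proof -
  obtain K where K: "\<And>n. (\<Sum>m\<in>coprime_upto b n. ln (real (lcm_perm_count (n div m) b))) \<ge>
      c_lcm b * real (totient b) / real b * real n - K"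
    using sum_ln_lcm_perm_count_ge[OF assms] by blast
  show ?thesis
  proof (intro exI conjI allI impI)
    \<comment> \<open>With this choice of error, multiplying by \<open>n\<close> turns it into the
      constant \<open>- K\<close> for every \<open>n \<ge> 1\<close>.\<close>
    show "(\<lambda>n. - K / real n) \<longlonglongrightarrow> 0" by (rule lim_const_over_n)
    fix n :: nat assume n: "n \<ge> 1"
    have "(c_lcm b * real (totient b) / real b + - K / real n) * real n =
        c_lcm b * real (totient b) / real b * real n - K"
      using n by (simp add: field_simps)
    then have "exp ((c_lcm b * real (totient b) / real b + - K / real n) * real n) \<le>
        exp (\<Sum>m\<in>coprime_upto b n. ln (real (lcm_perm_count (n div m) b)))"
      using K[of n] by simp
    also have "\<dots> = (\<Prod>m\<in>coprime_upto b n. real (lcm_perm_count (n div m) b))"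
      using lcm_perm_count_pos by (simp add: exp_sum)
    also have "\<dots> = real (\<Prod>m\<in>coprime_upto b n. lcm_perm_count (n div m) b)" by simp
    also have "\<dots> \<le> real (card (S_lcm n))"
      using prod_lcm_perm_count_le_card_S_lcm[OF assms] of_nat_mono by blast
    finally show "exp ((c_lcm b * real (totient b) / real b + - K / real n) * real n)
        \<le> real (card (S_lcm n))" .
  qed
qed

end
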